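(* Let $\mathcal{P}$ be a positive disjunctive Datalog program, and let $Rew(\mathcal{P}) = RV(\mathcal{P}) \cup ESV(\mathcal{P})$ be its rewritten version. Then for every atom $g(t)$ whose predicate symbol $g$ occurs in $\mathcal{P}$, the queries $\langle g(t), \mathcal{P}\rangle$ and $\langle g(t), Rew(\mathcal{P})\rangle$ are equivalent, $\langle g(t), \mathcal{P}\rangle \equiv \langle g(t), Rew(\mathcal{P})\rangle$; that is, for every database $D$ they have the same answer under the possible (brave) semantics and the same answer under the certain (cautious) semantics.
   Context: **Syntax.** Fix alphabets of constants, variables and predicate symbols. A term is a constant or a variable; atoms are $p(t_1,\dots,t_k)$ with $t_i$ terms (no function symbols). Predicate symbols are either base (extensional) or derived (intensional). A database $D$ is a finite set of ground facts over base predicates. A positive disjunctive Datalog program $\mathcal{P}$ is a finite set of rules $a_1\vee\cdots\vee a_m\leftarrow b_1,\dots,b_k$ with $m\ge 1$, $k\ge 0$, where the $a_i$ are atoms with derived predicate symbols and the $b_j$ are atoms (base or derived). $\mathcal{P}_D$ denotes $\mathcal{P}\cup D$. **Semantics.** $ground(\mathcal{P})$ is the set of instances of rules of $\mathcal{P}$ obtained by replacing variables with constants appearing in $\mathcal{P}$. An interpretation is a set of ground atoms over the predicates and constants of the program; it is a model if for every ground rule whose body is true, some head atom is true. For positive programs the stable models $\mathcal{SM}(\mathcal{P})$ are exactly the $\subseteq$-minimal models. A query is a pair $\langle G,\mathcal{P}\rangle$, $G$ an atom (the goal). For an interpretation $M$, $A(G,M)$ is the set of substitutions of constants for the variables of $G$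 making $G$ true in $M$. For a database $D$, the answer under possible (brave) semantics is $\bigcup_{M\in\mathcal{SM}(\mathcal{P}_D)}A(G,M)$; the answer under certain (cautious) semantics is $\bigcap_{M\in\mathcal{SM}(\mathcal{P}_D)}A(G,M)$. Two queries are equivalent ($\equiv$) if for every database their answers coincide under both semantics. **Rewriting.** $esv(\mathcal{P})$ is the program obtained by replacing each rule $a_1\vee\cdots\vee a_m\leftarrow B$ of $\mathcal{P}$ by the $m$ rules $a_i\leftarrow B$ ($1\le i\le m$) and the $m(m-1)$ rules $a_i\leftarrow a_j,B$ ($1\le i,j\le m$, $i\ne j$). $ESV(\mathcal{P})$ is obtained from $esv(\mathcal{P})$ by replacing every derived predicate symbol $p$ by a new (fresh, distinct) predicate symbol $P$ of the same arity; base predicates are unchanged. For a derived atom $a=p(s)$ write $A=P(s)$. Then $$RV(\mathcal{P})=\{a_1\vee\cdots\vee a_m\leftarrow A_1,\dots,A_m,B \;:\; a_1\vee\cdots\vee a_m\leftarrow B\in\mathcal{P}\},\qquad Rew(\mathcal{P})=RV(\mathcal{P})\cup ESV(\mathcal{P}).$$ *)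

theory Defs
  imports Main
begin

record 'p signature =
  base :: "'p set"
  arity :: "'p \<Rightarrow> nat"

abbreviation derived :: "('p, 'x) signature_scheme \<Rightarrow> 'p set" where
  "derived S \<equiv> - base S"

datatype ('c, 'v) trm = Const 'c | Var 'v

(* Atoms and rules are polymorphic in their arguments: ('c, 'v) trm for the
   objects of a program, 'c for ground ones. *)

datatype (preds_atom: 'p, args_atom: 't) atom = Atom (pred: 'p) (args: "'t list")
  for map: map_atom

(* Rule [a1, ..., am] [b1, ..., bk] is the rule  a1 \<or> ... \<or> am \<leftarrow> b1, ..., bk. *)

datatype (preds_rule: 'p, args_rule: 't) rule =
  Rule (head: "('p, 't) atom list") (body: "('p, 't) atom list")
  for map: map_rule

type_synonym ('p, 'c, 'v) program = "('p, ('c, 'v) trm) rule set"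
type_synonym ('p, 'c) interp = "('p, 'c) atom set"
type_synonym ('p, 'c, 'v) query = "('p, ('c, 'v) trm) atom \<times> ('p, 'c, 'v) program"

definition wf_atom :: "'p signature \<Rightarrow> ('p, 't) atom \<Rightarrow> bool" where
  "wf_atom S a \<longleftrightarrow> length (args a) = arity S (pred a)"

definition datalog_program :: "'p signature \<Rightarrow> ('p, 'c, 'v) program \<Rightarrow> bool" where
  "datalog_program S P \<longleftrightarrow> finite P \<and>
     (\<forall>r\<in>P. head r \<noteq> [] \<and>
            (\<forall>a\<in>set (head r). wf_atom S a \<and> pred a \<in> derived S) \<and>
            (\<forall>b\<in>set (body r). wf_atom S b))"

definition database :: "'p signature \<Rightarrow> ('p, 'c) atom set \<Rightarrow> bool" where
  "database S D \<longleftrightarrow> finite D \<and> (\<forall>a\<in>D. wf_atom S a \<and> pred a \<in> base S)"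

definition with_db :: "('p, 'c, 'v) program \<Rightarrow> ('p, 'c) atom set \<Rightarrow> ('p, 'c, 'v) program" where
  "with_db P D = P \<union> (\<lambda>a. Rule [map_atom id Const a] []) ` D"

definition preds_of :: "('p, 'c, 'v) program \<Rightarrow> 'p set" where
  "preds_of P = (\<Union>r\<in>P. preds_rule r)"

definition constants_of :: "('p, 'c, 'v) program \<Rightarrow> 'c set" where
  "constants_of P = {c. \<exists>r\<in>P. Const c \<in> args_rule r}"

fun subst_trm :: "('v \<Rightarrow> 'c) \<Rightarrow> ('c, 'v) trm \<Rightarrow> 'c" where
  "subst_trm \<sigma> (Const c) = c"
| "subst_trm \<sigma> (Var v) = \<sigma> v"

definition ground :: "('p, 'c, 'v) program \<Rightarrow> ('p, 'c) rule set" where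
  "ground P = {map_rule id (subst_trm \<sigma>) r | r \<sigma>.
     r \<in> P \<and> (\<forall>v. Var v \<in> args_rule r \<longrightarrow> \<sigma> v \<in> constants_of P)}"

definition interpretation_of :: "'p signature \<Rightarrow> ('p, 'c, 'v) program \<Rightarrow> ('p, 'c) interp \<Rightarrow> bool" where
  "interpretation_of S P M \<longleftrightarrow>
     (\<forall>a\<in>M. wf_atom S a \<and> pred a \<in> preds_of P \<and> args_atom a \<subseteq> constants_of P)"

definition model_of :: "'p signature \<Rightarrow> ('p, 'c, 'v) program \<Rightarrow> ('p, 'c) interp \<Rightarrow> bool" where
  "model_of S P M \<longleftrightarrow> interpretation_of S P M \<and>
     (\<forall>r\<in>ground P. set (body r) \<subseteq> M \<longrightarrow> (\<exists>a\<in>set (head r). a \<in> M))"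

(* Programs are negation-free, so the stable models are the minimal models. *)

definition stable_models :: "'p signature \<Rightarrow> ('p, 'c, 'v) program \<Rightarrow> ('p, 'c) interp set" where
  "stable_models S P = {M. model_of S P M \<and> (\<forall>N. model_of S P N \<and> N \<subseteq> M \<longrightarrow> N = M)}"

(* An answer is a partial map defined exactly on the variables of the goal. *)

definition answers :: "('p, ('c, 'v) trm) atom \<Rightarrow> ('p, 'c) interp \<Rightarrow> ('v \<rightharpoonup> 'c) set" where
  "answers G M = {\<theta>. dom \<theta> = {v. Var v \<in> args_atom G} \<and>
                     map_atom id (subst_trm (\<lambda>v. the (\<theta> v))) G \<in> M}"

definition possible_answer ::
    "'p signature \<Rightarrow> ('p, 'c, 'v) query \<Rightarrow> ('p, 'c) atom set \<Rightarrow> ('v \<rightharpoonup> 'c) set" where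
  "possible_answer S Q D = (\<Union>M\<in>stable_models S (with_db (snd Q) D). answers (fst Q) M)"

definition certain_answer ::
    "'p signature \<Rightarrow> ('p, 'c, 'v) query \<Rightarrow> ('p, 'c) atom set \<Rightarrow> ('v \<rightharpoonup> 'c) set" where
  "certain_answer S Q D = (\<Inter>M\<in>stable_models S (with_db (snd Q) D). answers (fst Q) M)"

definition query_equiv ::
    "'p signature \<Rightarrow> ('p, 'c, 'v) query \<Rightarrow> ('p, 'c, 'v) query \<Rightarrow> bool" where
  "query_equiv S Q Q' \<longleftrightarrow> (\<forall>D. database S D \<longrightarrow>
     possible_answer S Q D = possible_answer S Q' D \<and>
     certain_answer S Q D = certain_answer S Q' D)"

definition esv :: "('p, 'c, 'v) program \<Rightarrow> ('p, 'c, 'v) program" where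
  "esv P =
     {Rule [head r ! i] (body r) | r i. r \<in> P \<and> i < length (head r)} \<union>
     {Rule [head r ! i] (head r ! j # body r) | r i j.
        r \<in> P \<and> i < length (head r) \<and> j < length (head r) \<and> i \<noteq> j}"

(* \<nu> sends each derived predicate symbol p of P to the new symbol written P in
   the rewriting. The new symbols are themselves derived, hence absent from
   every database. *)

definition fresh_renaming :: "'p signature \<Rightarrow> ('p, 'c, 'v) program \<Rightarrow> ('p \<Rightarrow> 'p) \<Rightarrow> bool" where
  "fresh_renaming S P \<nu> \<longleftrightarrow>
     inj_on \<nu> (preds_of P \<inter> derived S) \<and>
     (\<forall>p \<in> preds_of P \<inter> derived S.
        \<nu> p \<in> derived S \<and> \<nu> p \<notin> preds_of P \<and> arity S (\<nu> p) = arity S p)"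

definition rename :: "'p signature \<Rightarrow> ('p \<Rightarrow> 'p) \<Rightarrow> 'p \<Rightarrow> 'p" where
  "rename S \<nu> p = (if p \<in> base S then p else \<nu> p)"

definition ESV :: "'p signature \<Rightarrow> ('p \<Rightarrow> 'p) \<Rightarrow> ('p, 'c, 'v) program \<Rightarrow> ('p, 'c, 'v) program" where
  "ESV S \<nu> P = map_rule (rename S \<nu>) id ` esv P"

definition RV :: "'p signature \<Rightarrow> ('p \<Rightarrow> 'p) \<Rightarrow> ('p, 'c, 'v) program \<Rightarrow> ('p, 'c, 'v) program" where
  "RV S \<nu> P = {Rule (head r) (map (map_atom (rename S \<nu>) id) (head r) @ body r) | r. r \<in> P}"

definition Rew :: "'p signature \<Rightarrow> ('p \<Rightarrow> 'p) \<Rightarrow> ('p, 'c, 'v) program \<Rightarrow> ('p, 'c, 'v) program" where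
  "Rew S \<nu> P = RV S \<nu> P \<union> ESV S \<nu> P"

end

theory Submission imports Defs begin

text \<open>
  Let \<open>L\<close> be the least set containing \<open>D\<close> and closed under all rules \<open>a\<^sub>i \<leftarrow> B\<close> obtained by
  splitting heads. A ground rule whose body lies in \<open>L\<close> has its whole head in \<open>L\<close>, so
  intersecting a model of \<open>P\<close> with \<open>L\<close> gives a model again; hence minimal models lie inside \<open>L\<close>,
  and there the guards \<open>A\<^sub>1, \<dots>, A\<^sub>m\<close> of the rewriting, which are evaluated in a renamed copy
  of \<open>L\<close>, hold whenever \<open>B\<close> does. Consequently \<open>M \<mapsto> M \<union> L'\<close>, with \<open>L'\<close> the renamed copy,
  is a surjection between the stable models of the two programs, and it does not change the atoms
  over the predicates of \<open>P\<close>.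
\<close>

section \<open>Maps on atoms and rules, and ground instances\<close>

abbreviation inst :: "('v \<Rightarrow> 'c) \<Rightarrow> ('p, ('c, 'v) trm) atom \<Rightarrow> ('p, 'c) atom" where
  "inst \<sigma> \<equiv> map_atom id (subst_trm \<sigma>)"

lemma pred_map_atom [simp]: "pred (map_atom f g a) = f (pred a)"
  by (cases a) simp

lemma args_map_atom [simp]: "args (map_atom f g a) = map g (args a)"
  by (cases a) simp

lemma preds_atom_eq [simp]: "preds_atom a = {pred a}"
  by (cases a) simp

lemma args_atom_eq: "args_atom a = set (args a)"
  by (cases a) simp

lemma args_rule_eq: "args_rule r = (\<Union>a\<in>set (head r) \<union> set (body r). args_atom a)"
  by (cases r) auto

lemma preds_rule_eq: "preds_rule r = pred ` (set (head r) \<union> set (body r))"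
  by (cases r) auto

lemma head_map_rule [simp]: "head (map_rule f g r) = map (map_atom f g) (head r)"
  by (cases r) simp

lemma body_map_rule [simp]: "body (map_rule f g r) = map (map_atom f g) (body r)"
  by (cases r) simp

lemma inst_Const [simp]: "inst \<sigma> (map_atom id Const a) = a"
  by (cases a) (simp add: comp_def)

section \<open>Models of a program joined with a database\<close>

lemma constants_with_db:
  fixes P :: "('p, 'c, 'v) program"
  shows "constants_of (with_db P D) = constants_of P \<union> (\<Union>a\<in>D. args_atom a)"
proof -
  have "Const c \<in> args_atom (map_atom id Const a :: ('p, ('c, 'v) trm) atom) \<longleftrightarrow> c \<in> args_atom a" for c and a :: "('p, 'c) atom"
    by (auto simp: args_atom_eq)
  then show ?thesis
    by (auto simp: constants_of_def with_db_def bex_Un)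
qed

lemma preds_with_db: "preds_of (with_db P D) = preds_of P \<union> pred ` D"
  by (auto simp: preds_of_def with_db_def preds_rule_eq)

text \<open>A fact has an empty body and no variables, so satisfying all facts amounts to
  \<open>D \<subseteq> M\<close>. Later arguments can then speak of rules of the program and
  valuations instead of \<open>ground\<close>. The valuations range over the constants of program
  and database together.\<close>

lemma model_of_with_db:
  fixes P :: "('p, 'c, 'v) program"
  shows "model_of S (with_db P D) M \<longleftrightarrow>
    interpretation_of S (with_db P D) M \<and> D \<subseteq> M \<and>
    (\<forall>r\<in>P. \<forall>\<sigma>. (\<forall>v. Var v \<in> args_rule r \<longrightarrow> \<sigma> v \<in> constants_of (with_db P D)) \<longrightarrow>
       inst \<sigma> ` set (body r) \<subseteq> M \<longrightarrow> (\<exists>a\<in>set (head r). inst \<sigma> a \<in> M))"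
proof -
  define C where "C = constants_of (with_db P D)"
  have *: "(\<forall>r\<in>ground (with_db P D). Q r) \<longleftrightarrow>
    (\<forall>r\<in>P. \<forall>\<sigma>. (\<forall>v. Var v \<in> args_rule r \<longrightarrow> \<sigma> v \<in> C) \<longrightarrow> Q (map_rule id (subst_trm \<sigma>) r)) \<and>
    (\<forall>a\<in>D. Q (Rule [a] []))" for Q
  proof -
    have fact: "map_rule id (subst_trm \<sigma>) (Rule [map_atom id Const a] []) = Rule [a] []"
      for \<sigma> :: "'v \<Rightarrow> 'c" and a :: "('p, 'c) atom"
      by simp
    have vars: "Var v \<notin> args_rule (Rule [map_atom id Const a] [])" for v :: 'v and a :: "('p, 'c) atom"
      by (auto simp: args_rule_eq args_atom_eq)
    have "(\<forall>r\<in>ground (with_db P D). Q r) \<longleftrightarrow> (\<forall>r\<in>with_db P D. \<forall>\<sigma>.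
        (\<forall>v. Var v \<in> args_rule r \<longrightarrow> \<sigma> v \<in> C) \<longrightarrow> Q (map_rule id (subst_trm \<sigma>) r))"
      unfolding ground_def C_def by blast
    then show ?thesis
      by (simp only: with_db_def ball_Un ball_simps vars fact) simp
  qed
  show ?thesis
    unfolding model_of_def * C_def by (simp add: subset_eq conj_ac)
qed

section \<open>Renamed atoms and the least overestimate\<close>

locale rewriting =
  fixes S :: "'p signature"
    and P :: "('p, 'c, 'v) program"
    and \<nu> :: "'p \<Rightarrow> 'p"
    and D :: "('p, 'c) atom set"
  assumes program: "datalog_program S P"
    and fresh: "fresh_renaming S P \<nu>"
    and db: "database S D"
begin

abbreviation "C \<equiv> constants_of (with_db P D)"

text \<open>This is the passage from \<open>a\<close> to \<open>A\<close> in the rewriting, fixing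
  base atoms. It is polymorphic in the arguments so that it applies to program atoms and to ground
  atoms alike.\<close>

definition copy :: "('p, 't) atom \<Rightarrow> ('p, 't) atom" where
  "copy = map_atom (rename S \<nu>) id"

lemma pred_copy [simp]: "pred (copy a) = rename S \<nu> (pred a)"
  by (simp add: copy_def)

lemma args_copy [simp]: "args (copy a) = args a"
  by (simp add: copy_def)

lemma args_atom_copy [simp]: "args_atom (copy a) = args_atom a"
  by (simp add: args_atom_eq)

lemma inst_copy [simp]: "inst \<sigma> (copy a) = copy (inst \<sigma> a)"
  by (cases a) (simp add: copy_def)

text \<open>Only the variables of the chosen head atom and of the body are restricted, exactly as
  for the split rule \<open>a \<leftarrow> B\<close>. If \<open>C\<close> is empty, a rule may have
  no ground instance although one of its split rules has one. The rules
  \<open>a_i \<leftarrow> a_j, B\<close> would add nothing, as their bodies extend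
  \<open>B\<close>.\<close>

inductive_set overestimate :: "('p, 'c) interp" where
  fact: "a \<in> D \<Longrightarrow> a \<in> overestimate"
| rule: "r \<in> P \<Longrightarrow> a \<in> set (head r) \<Longrightarrow>
    (\<forall>x\<in>insert a (set (body r)). \<forall>v. Var v \<in> args_atom x \<longrightarrow> \<sigma> v \<in> C) \<Longrightarrow>
    (\<forall>b\<in>set (body r). inst \<sigma> b \<in> overestimate) \<Longrightarrow> inst \<sigma> a \<in> overestimate"

lemma head_ne: "r \<in> P \<Longrightarrow> head r \<noteq> []"
  using program by (auto simp: datalog_program_def)

lemma head_atom: "r \<in> P \<Longrightarrow> a \<in> set (head r) \<Longrightarrow> wf_atom S a \<and> pred a \<notin> base S \<and> pred a \<in> preds_of P"
  using program by (auto simp: datalog_program_def preds_of_def preds_rule_eq)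

lemma body_pred: "r \<in> P \<Longrightarrow> a \<in> set (body r) \<Longrightarrow> pred a \<in> preds_of P"
  by (auto simp: preds_of_def preds_rule_eq)

lemma db_atom: "a \<in> D \<Longrightarrow> wf_atom S a \<and> pred a \<in> base S"
  using db by (auto simp: database_def)

text \<open>Rule heads are derived, so a base atom can only enter as a fact.\<close>

lemma overestimate_base: "a \<in> overestimate \<Longrightarrow> pred a \<in> base S \<Longrightarrow> a \<in> D"
  by (erule overestimate.cases) (auto dest: head_atom)

lemma inst_args:
  assumes "r \<in> P" "a \<in> set (head r) \<union> set (body r)" "\<forall>v. Var v \<in> args_atom a \<longrightarrow> \<sigma> v \<in> C"
  shows "args_atom (inst \<sigma> a) \<subseteq> C"
proof
  fix c assume "c \<in> args_atom (inst \<sigma> a)"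
  then obtain t where t: "t \<in> args_atom a" "c = subst_trm \<sigma> t"
    by (auto simp: args_atom_eq)
  show "c \<in> C"
  proof (cases t)
    case (Const d)
    with t assms show ?thesis
      unfolding constants_with_db by (auto simp: constants_of_def args_rule_eq)
  qed (use t assms in auto)
qed

lemma overestimate_interpretation: "interpretation_of S (with_db P D) overestimate"
  unfolding interpretation_of_def
proof
  fix a assume "a \<in> overestimate"
  then show "wf_atom S a \<and> pred a \<in> preds_of (with_db P D) \<and> args_atom a \<subseteq> C"
  proof cases
    case fact
    then show ?thesis
      using db_atom[of a] by (auto simp: preds_with_db constants_with_db)
  next
    case (rule r a' \<sigma>)
    then show ?thesis
      using head_atom[of r a'] inst_args[of r a' \<sigma>]
      by (auto simp: preds_with_db wf_atom_def)
  qed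
qed

text \<open>The condition for adding a head atom depends on the body and not on which disjunct is
  chosen, so all disjuncts enter together. This is what makes the guards of the rewriting
  harmless.\<close>

lemma head_in_overestimate:
  assumes "r \<in> P" "\<forall>v. Var v \<in> args_rule r \<longrightarrow> \<sigma> v \<in> C"
    "inst \<sigma> ` set (body r) \<subseteq> overestimate" "a \<in> set (head r)"
  shows "inst \<sigma> a \<in> overestimate"
  by (rule overestimate.rule[of r a \<sigma>]) (use assms in \<open>auto simp: args_rule_eq\<close>)

section \<open>Freshness and injectivity of the renaming\<close>

lemma derived_pred: "p \<in> preds_of (with_db P D) \<Longrightarrow> p \<notin> base S \<Longrightarrow> p \<in> preds_of P"
  using db_atom by (auto simp: preds_with_db)

text \<open>Freshness is assumed relative to \<open>P\<close> only. It extends to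
  \<open>with_db P D\<close> because the new symbols are derived and \<open>D\<close> uses base
  symbols only.\<close>

lemma rename_fresh:
  assumes "p \<in> preds_of (with_db P D)" "p \<notin> base S"
  shows "rename S \<nu> p \<notin> base S" "rename S \<nu> p \<notin> preds_of (with_db P D)"
    "arity S (rename S \<nu> p) = arity S p"
proof -
  have "pred ` D \<subseteq> base S" using db_atom by blast
  moreover have "\<nu> p \<notin> base S \<and> \<nu> p \<notin> preds_of P \<and> arity S (\<nu> p) = arity S p"
    using fresh derived_pred[OF assms] assms by (auto simp: fresh_renaming_def)
  ultimately show "rename S \<nu> p \<notin> base S" "rename S \<nu> p \<notin> preds_of (with_db P D)"
    "arity S (rename S \<nu> p) = arity S p"
    using assms by (auto simp: rename_def preds_with_db)
qed

lemma rename_base: "p \<in> base S \<Longrightarrow> rename S \<nu> p = p"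
  by (simp add: rename_def)

lemma arity_rename: "p \<in> preds_of (with_db P D) \<Longrightarrow> arity S (rename S \<nu> p) = arity S p"
  using rename_fresh(3) rename_base by metis

text \<open>Base symbols are fixed and derived ones go to derived ones, so the two kinds cannot
  collide; among derived symbols injectivity is that of \<open>\<nu>\<close>.\<close>

lemma rename_inj: "inj_on (rename S \<nu>) (preds_of (with_db P D))"
proof (rule inj_onI)
  fix p q
  assume pq: "p \<in> preds_of (with_db P D)" "q \<in> preds_of (with_db P D)" and eq: "rename S \<nu> p = rename S \<nu> q"
  have "p \<in> base S \<longleftrightarrow> q \<in> base S"
    using pq eq rename_fresh(1) rename_base by metis
  moreover have "inj_on \<nu> (preds_of P \<inter> derived S)"
    using fresh by (simp add: fresh_renaming_def)
  ultimately show "p = q"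
    using pq eq derived_pred by (auto simp: rename_def inj_on_def split: if_splits)
qed

lemma copy_base: "pred a \<in> base S \<Longrightarrow> copy a = a"
  by (cases a) (simp add: copy_def rename_base)

lemma copy_inj:
  assumes "copy a = copy b" "pred a \<in> preds_of (with_db P D)" "pred b \<in> preds_of (with_db P D)"
  shows "a = b"
  using assms rename_inj by (cases a; cases b) (auto simp: inj_on_def copy_def)

text \<open>The copy of a derived atom carries a fresh symbol. A copy with an old symbol therefore
  comes from a base atom, which is its own copy and a fact.\<close>

lemma copy_overestimate_old:
  assumes "a \<in> copy ` overestimate" "pred a \<in> preds_of (with_db P D)"
  shows "a \<in> D"
proof -
  obtain l where l: "l \<in> overestimate" "a = copy l" using assms by blast
  then have "pred l \<in> preds_of (with_db P D)"
    using overestimate_interpretation by (auto simp: interpretation_of_def)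
  then have "pred l \<in> base S"
    using l assms rename_fresh(2) by auto
  then show ?thesis
    using l overestimate_base by (simp add: copy_base)
qed

text \<open>Used to read bodies of \<open>ESV\<close> rules back. If \<open>copy b\<close> already
  lies in \<open>overestimate\<close>, its symbol is not fresh and \<open>b\<close> is a base atom;
  otherwise injectivity of \<open>copy\<close> applies.\<close>

lemma copy_in_overestimate:
  assumes "copy b \<in> overestimate \<union> copy ` overestimate" "pred b \<in> preds_of (with_db P D)"
  shows "b \<in> overestimate"
  using assms(1)
proof
  assume *: "copy b \<in> overestimate"
  then have "pred (copy b) \<in> preds_of (with_db P D)"
    using overestimate_interpretation by (auto simp: interpretation_of_def)
  then have "pred b \<in> base S"
    using rename_fresh(2) assms(2) by auto
  with * show ?thesis by (simp add: copy_base)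
next
  assume "copy b \<in> copy ` overestimate"
  then show ?thesis
    using copy_inj assms(2) overestimate_interpretation
    by (force simp: interpretation_of_def)
qed

section \<open>Rules, constants and predicates of the rewriting\<close>

text \<open>Handles both forms of split rule at once: \<open>bs\<close> is either \<open>B\<close>
  or \<open>a_j, B\<close>. The lower bound on \<open>bs\<close> serves derivations in
  \<open>overestimate\<close>, the upper bound the computation of constants.\<close>

lemma ESV_cases:
  assumes "r' \<in> ESV S \<nu> P"
  obtains r a bs where "r \<in> P" "a \<in> set (head r)" "set (body r) \<subseteq> set bs"
    "set bs \<subseteq> set (head r) \<union> set (body r)" "r' = Rule [copy a] (map copy bs)"
proof -
  from assms consider
      (1) r i where "r \<in> P" "i < length (head r)" "r' = map_rule (rename S \<nu>) id (Rule [head r ! i] (body r))"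
    | (2) r i j where "r \<in> P" "i < length (head r)" "j < length (head r)"
        "r' = map_rule (rename S \<nu>) id (Rule [head r ! i] (head r ! j # body r))"
    by (auto simp: ESV_def esv_def)
  then show ?thesis
  proof cases
    case 1
    then show ?thesis by (intro that[of r "head r ! i" "body r"]) (auto simp: copy_def)
  next
    case 2
    then show ?thesis by (intro that[of r "head r ! i" "head r ! j # body r"]) (auto simp: copy_def)
  qed
qed

lemma ESV_rule:
  assumes "r \<in> P" "a \<in> set (head r)"
  shows "Rule [copy a] (map copy (body r)) \<in> ESV S \<nu> P"
proof -
  obtain i where "i < length (head r)" "a = head r ! i"
    using assms by (auto simp: in_set_conv_nth)
  then have "Rule [a] (body r) \<in> esv P"
    using assms by (auto simp: esv_def)
  then show ?thesis
    by (force simp: ESV_def copy_def)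
qed

lemma RV_rule:
  assumes "r \<in> P"
  shows "Rule (head r) (map copy (head r) @ body r) \<in> RV S \<nu> P"
  using assms by (auto simp: RV_def copy_def)

lemma args_RV: "args_rule (Rule (head r) (map copy (head r) @ body r)) = args_rule r"
  unfolding args_rule_eq by auto

text \<open>Renaming leaves arguments alone and every new rule uses only atoms of one old rule,
  while each \<open>RV\<close> rule has all arguments of its source. Hence ground instances of both
  programs range over the same constants.\<close>

lemma constants_Rew: "constants_of (with_db (Rew S \<nu> P) D) = C"
proof -
  have "args_rule r' \<subseteq> (\<Union>r\<in>P. args_rule r)" if "r' \<in> Rew S \<nu> P" for r'
    using that unfolding Rew_def
  proof
    assume "r' \<in> RV S \<nu> P"
    then obtain r where r: "r \<in> P" "r' = Rule (head r) (map copy (head r) @ body r)"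
      by (auto simp: RV_def copy_def)
    show ?thesis unfolding r(2) args_RV using r(1) by blast
  next
    assume "r' \<in> ESV S \<nu> P"
    then obtain r a bs where r: "r \<in> P" "a \<in> set (head r)"
      "set bs \<subseteq> set (head r) \<union> set (body r)" "r' = Rule [copy a] (map copy bs)"
      by (rule ESV_cases)
    have "args_rule r' = args_atom a \<union> (\<Union>b\<in>set bs. args_atom b)"
      by (simp add: r(4))
    also have "\<dots> \<subseteq> args_rule r"
      unfolding args_rule_eq[of r] using r(2,3) by blast
    finally show ?thesis using r(1) by blast
  qed
  moreover have "args_rule r \<subseteq> (\<Union>r'\<in>Rew S \<nu> P. args_rule r')" if "r \<in> P" for r
    using RV_rule[OF that] args_RV[of r] unfolding Rew_def by blast
  ultimately have "constants_of (Rew S \<nu> P) = constants_of P"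
    unfolding constants_of_def by blast
  then show ?thesis by (simp add: constants_with_db)
qed

text \<open>Interpretations may only use occurring predicates, so both the old symbols and their
  copies must occur: the former do in \<open>RV\<close>, the latter in \<open>ESV\<close>, and
  symbols of \<open>D\<close> are not renamed.\<close>

lemma preds_Rew:
  assumes "p \<in> preds_of (with_db P D)"
  shows "p \<in> preds_of (with_db (Rew S \<nu> P) D)" "rename S \<nu> p \<in> preds_of (with_db (Rew S \<nu> P) D)"
proof -
  have *: "p \<in> preds_of (Rew S \<nu> P) \<and> rename S \<nu> p \<in> preds_of (Rew S \<nu> P)" if p: "p \<in> preds_of P"
  proof -
    obtain r x where r: "r \<in> P" "x \<in> set (head r) \<union> set (body r)" "p = pred x"
      using p by (auto simp: preds_of_def preds_rule_eq)
    \<comment> \<open>The head atom is chosen so that \<open>x\<close> occurs in the split rule for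
      \<open>a\<close>: any head atom if \<open>x\<close> is in the body, \<open>x\<close> itself
      otherwise.\<close>
    obtain a where a: "a \<in> set (head r)" "x \<in> set (body r) \<or> x = a"
      using r head_ne[of r] by (cases "head r") auto
    have "p \<in> preds_rule (Rule (head r) (map copy (head r) @ body r))"
      using r by (auto simp: preds_rule_eq)
    moreover have "rename S \<nu> p \<in> preds_rule (Rule [copy a] (map copy (body r)))"
      using r a by (auto simp: preds_rule_eq image_iff)
    ultimately show ?thesis
      using RV_rule[OF r(1)] ESV_rule[OF r(1) a(1)]
      unfolding preds_of_def Rew_def by blast
  qed
  have "p \<in> preds_of P \<or> p \<in> pred ` D \<and> rename S \<nu> p = p"
    using assms db_atom by (auto simp: preds_with_db rename_def)
  then show "p \<in> preds_of (with_db (Rew S \<nu> P) D)"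
    "rename S \<nu> p \<in> preds_of (with_db (Rew S \<nu> P) D)"
    unfolding preds_with_db using * by auto
qed

section \<open>Transfer of models between the two programs\<close>

text \<open>A body inside \<open>overestimate\<close> puts the whole head there, so whichever
  disjunct is true survives the intersection. The premise \<open>closed\<close> asks for a true
  disjunct only when the head lies in \<open>overestimate\<close>; this form covers models of
  \<open>P\<close> and also those of the rewriting, whose guards need that condition.\<close>

lemma model_Int_overestimate:
  assumes D: "D \<subseteq> M"
    and closed: "\<And>r \<sigma>. r \<in> P \<Longrightarrow> \<forall>v. Var v \<in> args_rule r \<longrightarrow> \<sigma> v \<in> C \<Longrightarrow>
      inst \<sigma> ` set (body r) \<subseteq> M \<Longrightarrow> inst \<sigma> ` set (head r) \<subseteq> overestimate \<Longrightarrow>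
      \<exists>a\<in>set (head r). inst \<sigma> a \<in> M"
  shows "model_of S (with_db P D) (M \<inter> overestimate)"
  unfolding model_of_with_db
proof (intro conjI ballI allI impI)
  show "interpretation_of S (with_db P D) (M \<inter> overestimate)"
    using overestimate_interpretation by (auto simp: interpretation_of_def)
  show "D \<subseteq> M \<inter> overestimate"
    using D by (auto intro: overestimate.fact)
  fix r and \<sigma> :: "'v \<Rightarrow> 'c"
  assume r: "r \<in> P" "\<forall>v. Var v \<in> args_rule r \<longrightarrow> \<sigma> v \<in> C"
    "inst \<sigma> ` set (body r) \<subseteq> M \<inter> overestimate"
  then have *: "inst \<sigma> ` set (head r) \<subseteq> overestimate"
    using head_in_overestimate by auto
  with r show "\<exists>a\<in>set (head r). inst \<sigma> a \<in> M \<inter> overestimate"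
    using closed[of r \<sigma>] by auto
qed

text \<open>By induction on \<open>overestimate\<close>: facts are their own copies, and each
  derivation step is mirrored by the renamed split rule in \<open>ESV\<close>.\<close>

lemma copy_overestimate_subset:
  assumes M: "model_of S (with_db (Rew S \<nu> P) D) M"
  shows "copy ` overestimate \<subseteq> M"
proof -
  have "copy a \<in> M" if "a \<in> overestimate" for a
    using that
  proof induction
    case (fact a)
    then show ?case
      using M db_atom[of a] by (auto simp: model_of_with_db copy_base)
  next
    case (rule r a \<sigma>)
    let ?r = "Rule [copy a] (map copy (body r))"
    have "?r \<in> Rew S \<nu> P"
      using rule ESV_rule by (auto simp: Rew_def)
    moreover have "\<forall>v. Var v \<in> args_rule ?r \<longrightarrow> \<sigma> v \<in> C"
      using rule by (auto simp: args_rule_eq)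
    moreover have "inst \<sigma> ` set (body ?r) \<subseteq> M"
      using rule by auto
    ultimately have "\<exists>x\<in>set (head ?r). inst \<sigma> x \<in> M"
      using M unfolding model_of_with_db constants_Rew by blast
    then show ?case by simp
  qed
  then show ?thesis by blast
qed

text \<open>When the head lies in \<open>overestimate\<close>, its copies lie in \<open>M\<close>,
  so all guards of the \<open>RV\<close> rule are true and the rule acts like the original
  one.\<close>

lemma model_of_Rew_restrict:
  assumes M: "model_of S (with_db (Rew S \<nu> P) D) M"
  shows "model_of S (with_db P D) (M \<inter> overestimate)"
proof (rule model_Int_overestimate)
  show "D \<subseteq> M" using M by (simp add: model_of_with_db)
  fix r and \<sigma> :: "'v \<Rightarrow> 'c"
  assume r: "r \<in> P" "\<forall>v. Var v \<in> args_rule r \<longrightarrow> \<sigma> v \<in> C"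
    "inst \<sigma> ` set (body r) \<subseteq> M" "inst \<sigma> ` set (head r) \<subseteq> overestimate"
  let ?r = "Rule (head r) (map copy (head r) @ body r)"
  have "?r \<in> Rew S \<nu> P"
    using r RV_rule by (auto simp: Rew_def)
  moreover have "\<forall>v. Var v \<in> args_rule ?r \<longrightarrow> \<sigma> v \<in> C"
    using r unfolding args_RV by blast
  moreover have "inst \<sigma> ` set (body ?r) \<subseteq> M"
    using r subsetD[OF copy_overestimate_subset[OF M]] by auto
  ultimately have "\<exists>x\<in>set (head ?r). inst \<sigma> x \<in> M"
    using M unfolding model_of_with_db constants_Rew by blast
  then show "\<exists>a\<in>set (head r). inst \<sigma> a \<in> M" by simp
qed

text \<open>An \<open>RV\<close> rule with true body has a true original body in \<open>K\<close>,
  so \<open>K\<close> supplies a head atom. An \<open>ESV\<close> rule with true body reads back to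
  a derivation step of \<open>overestimate\<close>.\<close>

lemma model_of_Rew_extend:
  assumes K: "model_of S (with_db P D) K" and sub: "K \<subseteq> overestimate"
  shows "model_of S (with_db (Rew S \<nu> P) D) (K \<union> copy ` overestimate)"
  unfolding model_of_with_db constants_Rew
proof (intro conjI ballI allI impI)
  have DK: "D \<subseteq> K" using K by (simp add: model_of_with_db)
  then show "D \<subseteq> K \<union> copy ` overestimate" by blast
  have L: "wf_atom S a \<and> pred a \<in> preds_of (with_db P D) \<and> args_atom a \<subseteq> C" if "a \<in> overestimate" for a
    using that overestimate_interpretation by (auto simp: interpretation_of_def)
  have wf_copy: "wf_atom S (copy a)" if "a \<in> overestimate" for a
    using L[OF that] by (simp add: wf_atom_def arity_rename)
  show "interpretation_of S (with_db (Rew S \<nu> P) D) (K \<union> copy ` overestimate)"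
    unfolding interpretation_of_def constants_Rew
  proof
    fix a assume "a \<in> K \<union> copy ` overestimate"
    then obtain l where "l \<in> overestimate" "a = l \<or> a = copy l"
      using sub by auto
    then show "wf_atom S a \<and> pred a \<in> preds_of (with_db (Rew S \<nu> P) D) \<and> args_atom a \<subseteq> C"
      using L[of l] wf_copy[of l] preds_Rew[of "pred l"] by (elim disjE) simp_all
  qed
  fix r' and \<sigma> :: "'v \<Rightarrow> 'c"
  assume r': "r' \<in> Rew S \<nu> P" and \<sigma>: "\<forall>v. Var v \<in> args_rule r' \<longrightarrow> \<sigma> v \<in> C"
    and body: "inst \<sigma> ` set (body r') \<subseteq> K \<union> copy ` overestimate"
  from r' show "\<exists>a\<in>set (head r'). inst \<sigma> a \<in> K \<union> copy ` overestimate"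
    unfolding Rew_def
  proof
    assume "r' \<in> RV S \<nu> P"
    then obtain r where r: "r \<in> P" "r' = Rule (head r) (map copy (head r) @ body r)"
      by (auto simp: RV_def copy_def)
    \<comment> \<open>Body atoms of \<open>r\<close> have old symbols, so those contributed by the
      copies are facts, which \<open>K\<close> contains.\<close>
    have "inst \<sigma> b \<in> K" if b: "b \<in> set (body r)" for b
    proof -
      have "inst \<sigma> b \<in> K \<union> copy ` overestimate" using body r b by auto
      moreover have "pred (inst \<sigma> b) \<in> preds_of (with_db P D)"
        using body_pred[OF r(1) b] by (simp add: preds_with_db)
      ultimately show ?thesis using copy_overestimate_old DK by blast
    qed
    then have "inst \<sigma> ` set (body r) \<subseteq> K" by blast
    then have "\<exists>a\<in>set (head r). inst \<sigma> a \<in> K"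
      using K r(1) \<sigma>[unfolded r(2) args_RV] unfolding model_of_with_db by blast
    then show ?thesis using r by auto
  next
    assume "r' \<in> ESV S \<nu> P"
    then obtain r a bs where r: "r \<in> P" "a \<in> set (head r)" "set (body r) \<subseteq> set bs"
      "r' = Rule [copy a] (map copy bs)"
      by (rule ESV_cases)
    have "inst \<sigma> b \<in> overestimate" if b: "b \<in> set (body r)" for b
    proof (rule copy_in_overestimate)
      have "copy (inst \<sigma> b) \<in> inst \<sigma> ` set (body r')"
        using r(3,4) b by (auto simp: image_image)
      then show "copy (inst \<sigma> b) \<in> overestimate \<union> copy ` overestimate"
        using body sub by blast
      show "pred (inst \<sigma> b) \<in> preds_of (with_db P D)"
        using body_pred[OF r(1) b] by (simp add: preds_with_db)
    qed
    then have "inst \<sigma> a \<in> overestimate"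
      using r \<sigma> by (intro overestimate.rule[of r a \<sigma>]) (auto simp: args_rule_eq)
    then show ?thesis using r by simp
  qed
qed

text \<open>Fresh symbols do not occur in \<open>overestimate\<close>, so it meets its copy only in
  facts. Intersecting thus undoes the extension by the copy.\<close>

lemma Int_overestimate_extend:
  assumes "D \<subseteq> K" "K \<subseteq> overestimate"
  shows "(K \<union> copy ` overestimate) \<inter> overestimate = K"
proof -
  have "pred a \<in> preds_of (with_db P D)" if "a \<in> overestimate" for a
    using that overestimate_interpretation by (auto simp: interpretation_of_def)
  then have "copy ` overestimate \<inter> overestimate \<subseteq> D"
    using copy_overestimate_old by blast
  with assms show ?thesis by blast
qed

section \<open>Correspondence of stable models and of answers\<close>

lemma stable_subset_overestimate:
  assumes "M \<in> stable_models S (with_db P D)"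
  shows "M \<subseteq> overestimate"
proof -
  have "model_of S (with_db P D) (M \<inter> overestimate)"
    using assms by (intro model_Int_overestimate) (auto simp: stable_models_def model_of_with_db)
  then have "M \<inter> overestimate = M"
    using assms by (auto simp: stable_models_def)
  then show ?thesis by blast
qed

text \<open>Restriction to \<open>overestimate\<close> and extension by its copy are monotone and
  preserve models in the respective directions, so a smaller model on one side would yield a smaller
  one on the other.\<close>

lemma stable_models_Rew:
  "stable_models S (with_db (Rew S \<nu> P) D) =
    (\<lambda>M. M \<union> copy ` overestimate) ` stable_models S (with_db P D)"
proof (intro equalityI subsetI)
  fix M' assume "M' \<in> stable_models S (with_db (Rew S \<nu> P) D)"
  then have M': "model_of S (with_db (Rew S \<nu> P) D) M'"
    and min: "\<And>N. model_of S (with_db (Rew S \<nu> P) D) N \<Longrightarrow> N \<subseteq> M' \<Longrightarrow> N = M'"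
    by (auto simp: stable_models_def)
  define K where "K = M' \<inter> overestimate"
  have K: "model_of S (with_db P D) K" "K \<subseteq> overestimate"
    using model_of_Rew_restrict[OF M'] by (auto simp: K_def)
  \<comment> \<open>Extending \<open>N\<close> gives a model of the rewriting inside
    \<open>M'\<close>, so minimality forces equality. The case \<open>N = K\<close> shows that
    \<open>M'\<close> is itself an extension.\<close>
  have extend: "N \<union> copy ` overestimate = M'" if N: "model_of S (with_db P D) N" "N \<subseteq> K" for N
    using N K model_of_Rew_extend[of N] copy_overestimate_subset[OF M']
    by (intro min) (auto simp: K_def)
  have "N = K" if N: "model_of S (with_db P D) N" "N \<subseteq> K" for N
  proof -
    have "K = (N \<union> copy ` overestimate) \<inter> overestimate"
      using extend[OF N] by (simp add: K_def)
    also have "\<dots> = N"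
      using N K by (intro Int_overestimate_extend) (auto simp: model_of_with_db)
    finally show ?thesis by simp
  qed
  then have "K \<in> stable_models S (with_db P D)"
    using K by (auto simp: stable_models_def)
  then show "M' \<in> (\<lambda>M. M \<union> copy ` overestimate) ` stable_models S (with_db P D)"
    using extend[OF K(1)] by blast
next
  fix M' assume "M' \<in> (\<lambda>M. M \<union> copy ` overestimate) ` stable_models S (with_db P D)"
  then obtain M where stable: "M \<in> stable_models S (with_db P D)" and M': "M' = M \<union> copy ` overestimate"
    by blast
  have M: "model_of S (with_db P D) M" "M \<subseteq> overestimate" "D \<subseteq> M"
    using stable stable_subset_overestimate by (auto simp: stable_models_def model_of_with_db)
  have "N = M'" if N: "model_of S (with_db (Rew S \<nu> P) D) N" "N \<subseteq> M'" for N
  proof -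
    have "N \<inter> overestimate \<subseteq> M"
      using N(2) M Int_overestimate_extend[of M] M' by blast
    \<comment> \<open>The restriction of \<open>N\<close> is a model of \<open>P\<close> inside the
      minimal model \<open>M\<close>.\<close>
    then have "N \<inter> overestimate = M"
      using stable model_of_Rew_restrict[OF N(1)] by (auto simp: stable_models_def)
    then show ?thesis
      using N M' copy_overestimate_subset[OF N(1)] by blast
  qed
  then show "M' \<in> stable_models S (with_db (Rew S \<nu> P) D)"
    using model_of_Rew_extend[OF M(1,2)] M' by (auto simp: stable_models_def)
qed

text \<open>Instances of \<open>G\<close> have an old symbol, and the only added atoms with old
  symbols are facts, already in \<open>M\<close>.\<close>

lemma answers_extend:
  assumes "pred G \<in> preds_of P" "D \<subseteq> M"
  shows "answers G (M \<union> copy ` overestimate) = answers G M"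
proof -
  have "inst \<sigma> G \<in> M \<union> copy ` overestimate \<longleftrightarrow> inst \<sigma> G \<in> M" for \<sigma>
    using assms copy_overestimate_old[of "inst \<sigma> G"] by (auto simp: preds_with_db)
  then show ?thesis
    by (simp add: answers_def)
qed

lemma answers_Rew:
  assumes "pred G \<in> preds_of P"
  shows "possible_answer S (G, P) D = possible_answer S (G, Rew S \<nu> P) D"
    and "certain_answer S (G, P) D = certain_answer S (G, Rew S \<nu> P) D"
proof -
  have "answers G (M \<union> copy ` overestimate) = answers G M" if "M \<in> stable_models S (with_db P D)" for M
    using that assms by (intro answers_extend) (auto simp: stable_models_def model_of_with_db)
  then show "possible_answer S (G, P) D = possible_answer S (G, Rew S \<nu> P) D"
    and "certain_answer S (G, P) D = certain_answer S (G, Rew S \<nu> P) D"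
    by (simp_all add: possible_answer_def certain_answer_def stable_models_Rew)
qed

end

theorem proposition1:
  fixes S :: "'p signature"
    and P :: "('p, 'c, 'v) program"
    and \<nu> :: "'p \<Rightarrow> 'p"
    and G :: "('p, ('c, 'v) trm) atom"
  assumes "datalog_program S P"
    and "fresh_renaming S P \<nu>"
    and "wf_atom S G"
    and "pred G \<in> preds_of P"
  shows "query_equiv S (G, P) (G, Rew S \<nu> P)"
  unfolding query_equiv_def
proof (intro allI impI)
  fix D :: "('p, 'c) atom set"
  assume "database S D"
  with assms(1,2) interpret rewriting S P \<nu> D
    by unfold_locales
  show "possible_answer S (G, P) D = possible_answer S (G, Rew S \<nu> P) D \<and>
    certain_answer S (G, P) D = certain_answer S (G, Rew S \<nu> P) D"
    using answers_Rew assms(4) by blast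
qed

end
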